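(* Let $m_v>0$. Let $M$ be the $2n\times2n$ matrix given by $$(M\mathbf u)_i=\Delta x\, m_v\left(-\tfrac12u_{i-1/2}+u_i-\tfrac12u_{i+1/2}\right),$$ $$(M\mathbf u)_{i+1/2}=\Delta x\, m_v\left(\tfrac16u_{i-1/2}-\tfrac12u_i+\tfrac23u_{i+1/2}-\tfrac12u_{i+1}+\tfrac16u_{i+3/2}\right),$$ and let $D_+,D_-$ be the $2n\times2n$ upwind Active Flux matrices given by $$(D_\pm\mathbf u)_i=\frac{u_{i+1/2}-u_{i-1/2}}{\Delta x},\qquad (D_+\mathbf u)_{i+1/2}=\frac{-4u_{i+1/2}+6u_{i+1}-2u_{i+3/2}}{\Delta x},\qquad (D_-\mathbf u)_{i+1/2}=\frac{2u_{i-1/2}-6u_i+4u_{i+1/2}}{\Delta x}.$$ Then the matrix $M(D_+-D_-)$ is symmetric and negative semidefinite.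
   Context: Uniform periodic grid with $n$ cells of size $\Delta x>0$. The unknowns are cell averages $u_i$ and interface point values $u_{i+1/2}$, with $u_{i+n}=u_i$, $u_{i+n+1/2}=u_{i+1/2}$ (cell indices modulo $n$), collected in $\mathbf u=(u_{-1/2},u_0,u_{1/2},u_1,\dots,u_{n-3/2},u_{n-1})^T\in\mathbb R^{2n}$. For a $2n\times2n$ matrix $A$, $(A\mathbf u)_i$ and $(A\mathbf u)_{i+1/2}$ denote the components of $A\mathbf u$ at the positions of $u_i$ and $u_{i+1/2}$. *)

theory Defs
  imports "Jordan_Normal_Form.Matrix"
begin

text \<open>
  A state is stored as \<open>u = (u_{-1/2}, u_0, u_{1/2}, u_1, \<dots>, u_{n-3/2}, u_{n-1})\<close>, a vector of
  dimension \<open>2 * n\<close>: for \<open>0 \<le> i < n\<close>, entry \<open>2 * i\<close> is \<open>u_{i-1/2}\<close> and entry \<open>2 * i + 1\<close> is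
  \<open>u_i\<close>. Cell indices are integers read modulo \<open>n\<close>, so that \<open>point_val n u i\<close>, which stands for
  \<open>u_{i+1/2} = u_{(i+1)-1/2}\<close>, sits at an entry computed from \<open>i + 1\<close>.
\<close>

definition cell_avg :: "nat \<Rightarrow> real vec \<Rightarrow> int \<Rightarrow> real" where
  "cell_avg n u i = u $ (2 * nat (i mod int n) + 1)"

definition point_val :: "nat \<Rightarrow> real vec \<Rightarrow> int \<Rightarrow> real" where
  "point_val n u i = u $ (2 * nat ((i + 1) mod int n))"

definition symmetric_mat :: "real mat \<Rightarrow> bool" where
  "symmetric_mat A \<longleftrightarrow> square_mat A \<and> A\<^sup>T = A"

definition neg_semidefinite :: "real mat \<Rightarrow> bool" where
  "neg_semidefinite A \<longleftrightarrow>
     square_mat A \<and> (\<forall>x \<in> carrier_vec (dim_row A). x \<bullet> (A *\<^sub>v x) \<le> 0)"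

end

theory Submission
  imports Defs
begin

text \<open>
  The two upwind operators agree on cell averages, so \<open>w = (D\<^sub>+ - D\<^sub>-) u\<close> has vanishing averages;
  its point values are \<open>- 6 / \<Delta>x\<close> times the symmetric five-point stencil
  \<open>g\<^sub>i(u) = u_{i-1/2} / 3 - u_i + 4 u_{i+1/2} / 3 - u_{i+1} + u_{i+3/2} / 3\<close>
  (\<open>upwind_stencil\<close>). On the vectors with vanishing averages, pairing \<open>M w\<close> with a vector \<open>x\<close> and
  summing by parts over the periodic grid moves all the shifts from \<open>w\<close> to \<open>x\<close>, and the same
  stencil comes out: \<open>x \<bullet> M w = (\<Delta>x m\<^sub>v / 2) (\<Sum>i. w_{i+1/2} g\<^sub>i(x))\<close>. Together,
  \<open>x \<bullet> M (D\<^sub>+ - D\<^sub>-) u = - 3 m\<^sub>v (\<Sum>i. g\<^sub>i(x) g\<^sub>i(u))\<close>,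
  that is, the matrix is \<open>- 3 m\<^sub>v G\<^sup>T G\<close> with \<open>G u = (g\<^sub>i(u))\<^sub>i\<close>, which is symmetric and negative
  semidefinite.
\<close>

lemma sum_periodic_shift:
  fixes f :: "int \<Rightarrow> 'a::comm_monoid_add"
  assumes "f (int n) = f 0"
  shows "(\<Sum>i<n. f (int i + 1)) = (\<Sum>i<n. f (int i))"
proof (cases n)
  case 0
  then show ?thesis by simp
next
  case (Suc k)
  have "(\<Sum>i<n. f (int i + 1)) = (\<Sum>i<k. f (int i + 1)) + f (int n)"
    unfolding Suc by (simp add: add.commute)
  also have "\<dots> = (\<Sum>i<n. f (int i))"
    using assms unfolding Suc sum.lessThan_Suc_shift by (simp add: add.commute)
  finally show ?thesis .
qed

lemma point_val_periodic [simp]: "point_val n u (int n + i) = point_val n u i"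
proof -
  have "(int n + i + 1) mod int n = (i + 1) mod int n"
    by (metis add.assoc mod_add_self1)
  then show ?thesis by (simp add: point_val_def)
qed

lemma cell_avg_periodic [simp]: "cell_avg n u (int n + i) = cell_avg n u i"
  by (simp add: cell_avg_def)

text \<open>
  Point value \<open>i\<close> is stored next to cell \<open>i + 1\<close>, so pairing it with cell \<open>i\<close> costs one periodic
  shift.
\<close>

lemma scalar_prod_eq_grid_sum:
  assumes "v \<in> carrier_vec (2 * n)"
  shows "u \<bullet> v =
    (\<Sum>i<n. cell_avg n u (int i) * cell_avg n v (int i)
          + point_val n u (int i) * point_val n v (int i))"
proof -
  have even_odd: "(\<Sum>k<2 * m. f k) = (\<Sum>i<m. f (2 * i) + f (2 * i + 1))"
    for m and f :: "nat \<Rightarrow> real"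
    by (induction m) (auto simp: algebra_simps)
  have "u \<bullet> v = (\<Sum>k<2 * n. u $ k * v $ k)"
    using assms by (simp add: scalar_prod_def atLeast0LessThan)
  also have "\<dots> = (\<Sum>i<n. u $ (2 * i + 1) * v $ (2 * i + 1)) + (\<Sum>i<n. u $ (2 * i) * v $ (2 * i))"
    by (simp add: even_odd sum.distrib)
  also have "(\<Sum>i<n. u $ (2 * i + 1) * v $ (2 * i + 1))
      = (\<Sum>i<n. cell_avg n u (int i) * cell_avg n v (int i))"
    by (rule sum.cong) (auto simp: cell_avg_def)
  also have "(\<Sum>i<n. u $ (2 * i) * v $ (2 * i))
      = (\<Sum>i<n. point_val n u (int i - 1) * point_val n v (int i - 1))"
    by (rule sum.cong) (auto simp: point_val_def)
  also have "\<dots> = (\<Sum>i<n. point_val n u (int i) * point_val n v (int i))"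
    using sum_periodic_shift[of "\<lambda>i. point_val n u (i - 1) * point_val n v (i - 1)" n]
      point_val_periodic[of n _ "-1"]
    by simp
  finally show ?thesis by (simp add: sum.distrib)
qed

lemma cell_avg_minus:
  assumes "n \<ge> 1" "u \<in> carrier_vec (2 * n)" "v \<in> carrier_vec (2 * n)"
  shows "cell_avg n (u - v) i = cell_avg n u i - cell_avg n v i"
proof -
  have "nat (i mod int n) < n" using assms by (simp add: nat_less_iff)
  then show ?thesis using assms by (simp add: cell_avg_def)
qed

lemma point_val_minus:
  assumes "n \<ge> 1" "u \<in> carrier_vec (2 * n)" "v \<in> carrier_vec (2 * n)"
  shows "point_val n (u - v) i = point_val n u i - point_val n v i"
proof -
  have "nat ((i + 1) mod int n) < n" using assms by (simp add: nat_less_iff)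
  then show ?thesis using assms by (simp add: point_val_def)
qed

lemma symmetric_matI_bilinear:
  assumes A: "A \<in> carrier_mat m m"
    and sym: "\<And>x y. x \<in> carrier_vec m \<Longrightarrow> y \<in> carrier_vec m \<Longrightarrow>
      x \<bullet> (A *\<^sub>v y) = y \<bullet> (A *\<^sub>v x)"
  shows "symmetric_mat A"
proof -
  have entry: "unit_vec m i \<bullet> (A *\<^sub>v unit_vec m j) = A $$ (i, j)" if "i < m" "j < m" for i j
    using A that by (simp add: scalar_prod_left_unit)
  have "A\<^sup>T = A"
  proof (rule eq_matI)
    fix i j assume "i < dim_row A" "j < dim_col A"
    then have ij: "i < m" "j < m" using A by auto
    have "A $$ (j, i) = A $$ (i, j)"
      using sym[of "unit_vec m j" "unit_vec m i"] entry ij by (metis unit_vec_carrier)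
    then show "A\<^sup>T $$ (i, j) = A $$ (i, j)" using A ij by simp
  qed (use A in auto)
  then show ?thesis using A by (auto simp: symmetric_mat_def)
qed

definition upwind_stencil :: "nat \<Rightarrow> real vec \<Rightarrow> int \<Rightarrow> real" where
  "upwind_stencil n u i =
     (1/3) * point_val n u (i - 1) - cell_avg n u i + (4/3) * point_val n u i
       - cell_avg n u (i + 1) + (1/3) * point_val n u (i + 1)"

text \<open>
  Summation by parts: on the left the shifts act on \<open>w\<close>, the point values of a vector with vanishing
  cell averages, and on the right they act on \<open>x\<close>. The coefficients
  \<open>1/6, -1/2, 2/3, -1/2, 1/6\<close> are half those of the stencil, whence the factor \<open>1/2\<close>.
\<close>

lemma sum_by_parts_upwind_stencil:
  fixes w :: "int \<Rightarrow> real"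
  assumes w: "\<And>i. w (int n + i) = w i"
  shows "(\<Sum>i<n. cell_avg n x (int i) * (- (1/2) * w (int i - 1) - (1/2) * w (int i))
            + point_val n x (int i) *
                ((1/6) * w (int i - 1) + (2/3) * w (int i) + (1/6) * w (int i + 1)))
       = (1/2) * (\<Sum>i<n. w (int i) * upwind_stencil n x (int i))"
proof -
  let ?c = "cell_avg n x" and ?p = "point_val n x"
  have w': "w (int n) = w 0" "w (int n - 1) = w (-1)"
    using w[of 0] w[of "-1"] by simp_all
  have per: "?c (int n) = ?c 0" "?p (int n) = ?p 0" "?p (int n - 1) = ?p (-1)"
    using cell_avg_periodic[of n x 0] point_val_periodic[of n x 0] point_val_periodic[of n x "-1"]
    by simp_all
  have c: "(\<Sum>i<n. ?c (int i) * w (int i - 1)) = (\<Sum>i<n. ?c (int i + 1) * w (int i))"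
    using sum_periodic_shift[of "\<lambda>i. ?c i * w (i - 1)" n] w' per by simp
  have l: "(\<Sum>i<n. ?p (int i) * w (int i - 1)) = (\<Sum>i<n. ?p (int i + 1) * w (int i))"
    using sum_periodic_shift[of "\<lambda>i. ?p i * w (i - 1)" n] w' per by simp
  have r: "(\<Sum>i<n. ?p (int i) * w (int i + 1)) = (\<Sum>i<n. ?p (int i - 1) * w (int i))"
    using sum_periodic_shift[of "\<lambda>i. ?p (i - 1) * w i" n] w' per by simp
  have "(\<Sum>i<n. ?c (int i) * (- (1/2) * w (int i - 1) - (1/2) * w (int i))
            + ?p (int i) * ((1/6) * w (int i - 1) + (2/3) * w (int i) + (1/6) * w (int i + 1)))
      = (\<Sum>i<n. - (1/2) * (?c (int i) * w (int i - 1)) - (1/2) * (?c (int i) * w (int i))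
            + (1/6) * (?p (int i) * w (int i - 1)) + (2/3) * (?p (int i) * w (int i))
            + (1/6) * (?p (int i) * w (int i + 1)))"
    by (rule sum.cong) (auto simp: algebra_simps)
  also have "\<dots> = - (1/2) * (\<Sum>i<n. ?c (int i) * w (int i - 1))
        - (1/2) * (\<Sum>i<n. ?c (int i) * w (int i))
        + (1/6) * (\<Sum>i<n. ?p (int i) * w (int i - 1)) + (2/3) * (\<Sum>i<n. ?p (int i) * w (int i))
        + (1/6) * (\<Sum>i<n. ?p (int i) * w (int i + 1))"
    by (simp only: sum.distrib sum_subtractf sum_distrib_left)
  also have "\<dots> = (\<Sum>i<n. - (1/2) * (?c (int i + 1) * w (int i))
        - (1/2) * (?c (int i) * w (int i))
        + (1/6) * (?p (int i + 1) * w (int i)) + (2/3) * (?p (int i) * w (int i))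
        + (1/6) * (?p (int i - 1) * w (int i)))"
    unfolding c l r by (simp only: sum.distrib sum_subtractf sum_distrib_left)
  also have "\<dots> = (1/2) * (\<Sum>i<n. w (int i) * upwind_stencil n x (int i))"
    unfolding sum_distrib_left
    by (rule sum.cong) (auto simp: upwind_stencil_def algebra_simps)
  finally show ?thesis .
qed

theorem lemma3p11:
  fixes n :: nat and \<Delta>x m\<^sub>v :: real and M D\<^sub>p D\<^sub>m :: "real mat"
  assumes n: "n \<ge> 1" and dx: "\<Delta>x > 0" and mv: "m\<^sub>v > 0"
    and M_dim: "M \<in> carrier_mat (2 * n) (2 * n)"
    and M_cell: "\<And>u i. u \<in> carrier_vec (2 * n) \<Longrightarrow>
      cell_avg n (M *\<^sub>v u) i =
        \<Delta>x * m\<^sub>v * (- (1/2) * point_val n u (i - 1) + cell_avg n u i - (1/2) * point_val n u i)"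
    and M_point: "\<And>u i. u \<in> carrier_vec (2 * n) \<Longrightarrow>
      point_val n (M *\<^sub>v u) i =
        \<Delta>x * m\<^sub>v * ((1/6) * point_val n u (i - 1) - (1/2) * cell_avg n u i
          + (2/3) * point_val n u i - (1/2) * cell_avg n u (i + 1) + (1/6) * point_val n u (i + 1))"
    and Dp_dim: "D\<^sub>p \<in> carrier_mat (2 * n) (2 * n)"
    and Dp_cell: "\<And>u i. u \<in> carrier_vec (2 * n) \<Longrightarrow>
      cell_avg n (D\<^sub>p *\<^sub>v u) i = (point_val n u i - point_val n u (i - 1)) / \<Delta>x"
    and Dp_point: "\<And>u i. u \<in> carrier_vec (2 * n) \<Longrightarrow>
      point_val n (D\<^sub>p *\<^sub>v u) i =
        (- 4 * point_val n u i + 6 * cell_avg n u (i + 1) - 2 * point_val n u (i + 1)) / \<Delta>x"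
    and Dm_dim: "D\<^sub>m \<in> carrier_mat (2 * n) (2 * n)"
    and Dm_cell: "\<And>u i. u \<in> carrier_vec (2 * n) \<Longrightarrow>
      cell_avg n (D\<^sub>m *\<^sub>v u) i = (point_val n u i - point_val n u (i - 1)) / \<Delta>x"
    and Dm_point: "\<And>u i. u \<in> carrier_vec (2 * n) \<Longrightarrow>
      point_val n (D\<^sub>m *\<^sub>v u) i =
        (2 * point_val n u (i - 1) - 6 * cell_avg n u i + 4 * point_val n u i) / \<Delta>x"
  shows "symmetric_mat (M * (D\<^sub>p - D\<^sub>m)) \<and> neg_semidefinite (M * (D\<^sub>p - D\<^sub>m))"
proof -
  let ?A = "M * (D\<^sub>p - D\<^sub>m)"
  have A: "?A \<in> carrier_mat (2 * n) (2 * n)"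
    using M_dim Dm_dim by (intro mult_carrier_mat minus_carrier_mat)
  have form: "x \<bullet> (?A *\<^sub>v u) =
      - 3 * m\<^sub>v * (\<Sum>i<n. upwind_stencil n x (int i) * upwind_stencil n u (int i))"
    if u: "u \<in> carrier_vec (2 * n)" for x u
  proof -
    define w where "w = D\<^sub>p *\<^sub>v u - D\<^sub>m *\<^sub>v u"
    have wc: "w \<in> carrier_vec (2 * n)"
      using u Dp_dim Dm_dim unfolding w_def by (intro minus_carrier_vec mult_mat_vec_carrier)
    have Au: "?A *\<^sub>v u = M *\<^sub>v w"
      unfolding w_def minus_mult_distrib_mat_vec[OF Dp_dim Dm_dim u, symmetric]
      by (rule assoc_mult_mat_vec[OF M_dim minus_carrier_mat[OF Dm_dim] u])
    have w_cell: "cell_avg n w i = 0" for i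
      using u Dp_dim Dm_dim by (simp add: w_def cell_avg_minus[OF n] Dp_cell Dm_cell)
    have w_point: "point_val n w i = - 6 / \<Delta>x * upwind_stencil n u i" for i
      using u Dp_dim Dm_dim dx
      by (simp add: w_def point_val_minus[OF n] Dp_point Dm_point upwind_stencil_def field_simps)
    have "x \<bullet> (?A *\<^sub>v u) = \<Delta>x * m\<^sub>v *
      (\<Sum>i<n. cell_avg n x (int i) *
              (- (1/2) * point_val n w (int i - 1) - (1/2) * point_val n w (int i))
            + point_val n x (int i) *
              ((1/6) * point_val n w (int i - 1) + (2/3) * point_val n w (int i)
                + (1/6) * point_val n w (int i + 1)))"
      unfolding Au using M_dim wc
      by (subst scalar_prod_eq_grid_sum)
        (auto simp: sum_distrib_left M_cell M_point w_cell algebra_simps intro!: sum.cong)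
    also have "\<dots> = \<Delta>x * m\<^sub>v * ((1/2) * (\<Sum>i<n. point_val n w (int i) * upwind_stencil n x (int i)))"
      by (subst sum_by_parts_upwind_stencil) simp_all
    also have "\<dots> = - 3 * m\<^sub>v * (\<Sum>i<n. upwind_stencil n x (int i) * upwind_stencil n u (int i))"
      using dx unfolding w_point sum_distrib_left
      by (intro sum.cong) (auto simp: field_simps)
    finally show ?thesis .
  qed
  have "symmetric_mat ?A"
    by (rule symmetric_matI_bilinear[OF A]) (simp add: form mult.commute)
  moreover have "x \<bullet> (?A *\<^sub>v x) \<le> 0" if "x \<in> carrier_vec (2 * n)" for x
  proof -
    have "0 \<le> (\<Sum>i<n. upwind_stencil n x (int i) * upwind_stencil n x (int i))"
      by (simp add: sum_nonneg)
    then show ?thesis using mv by (simp add: form[OF that])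
  qed
  then have "neg_semidefinite ?A"
    using A M_dim Dm_dim by (auto simp: neg_semidefinite_def)
  ultimately show ?thesis ..
qed

end
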